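(* Let $\Phi$ be a consistent theory over RPL$\forall$. For every RPL$\forall$-Horn clause $\varphi$ without free variables, if $|\varphi|_{\Phi}=1$, then $\|\varphi\|_{\mathbf{T}^{\Phi}}=1$, where $\langle[0,1]_{\mathrm{RPL}},\mathbf{T}^{\Phi}\rangle$ is the term structure associated to $\Phi$.
   Context: **Logic.** RPL$\forall$ (Rational Pavelka predicate logic) is first-order Łukasiewicz logic with a truth constant $\overline r$ for each rational $r\in[0,1]$. Conventions: $\neg\varphi:=\varphi\to\overline 0$, $\varphi\&\psi:=\neg(\varphi\to\neg\psi)$, $\varphi\leftrightarrow\psi:=(\varphi\to\psi)\&(\psi\to\varphi)$, $(\exists x)\varphi:=\neg(\forall x)\neg\varphi$. On $[0,1]$: $a\to b=\min\{1,1-a+b\}$ and $a\& b=\max\{0,a+b-1\}$. Every predicate language contains a binary predicate symbol $\approx$. Axioms: $\varphi\to(\psi\to\varphi)$; $(\varphi\to\psi)\to((\psi\to\xi)\to(\varphi\to\xi))$; $(\neg\psi\to\neg\varphi)\to(\varphi\to\psi)$; $((\varphi\to\psi)\to\psi)\to((\psi\to\varphi)\to\varphi)$; $(\overline r\to\overline s)\leftrightarrow\overline{r\to s}$; $(\overline r\&\overline s)\leftrightarrow\overline{r\& s}$; $(\forall x)\varphi(x)\to\varphi(t)$ for $t$ substitutable for $x$ in $\varphi$; $(\forall x)(\xi\to\varphi)\to(\xi\to(\forall x)\varphi)$ for $x$ not free in $\xi$; and the similarity and congruence axioms: (S1) $(\forall x)\,x\approx x$; (S2) $(\forall x)(\forall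 y)(x\approx y\to y\approx x)$; (S3) $(\forall x)(\forall y)(\forall z)(x\approx y\& y\approx z\to x\approx z)$; (C1) for each $n$-ary function symbol $F$, the universal closure of $x_1\approx y_1\&\cdots\& x_n\approx y_n\to F(x_1,\dots,x_n)\approx F(y_1,\dots,y_n)$; (C2) for each $n$-ary predicate symbol $P$, the universal closure of $x_1\approx y_1\&\cdots\& x_n\approx y_n\to(P(x_1,\dots,x_n)\leftrightarrow P(y_1,\dots,y_n))$. Rules: Modus Ponens and Generalization (from $\varphi$ infer $(\forall x)\varphi$). $\vdash$ denotes provability in this system. A theory is a set of sentences; $\Phi$ is consistent if $\Phi\not\vdash\overline 0$. **Semantics.** A structure $\langle[0,1]_{\mathrm{RPL}},\mathbf M\rangle$ consists of a non-empty domain $M$, a function $P_{\mathbf M}:M^n\to[0,1]$ for each $n$-ary predicate symbol $P$, and a function $F_{\mathbf M}:M^n\to M$ for each $n$-ary function symbol $F$. An $\mathbf M$-evaluation $v$ maps variables to $M$. Values $\|t\|_{\mathbf M,v}\in M$ of terms and truth values $\|\varphi\|_{\mathbf M,v}\in[0,1]$ of formulas are defined recursively as usual, with $\overline r$ having value $r$, connectives interpreted by the operations above on the standard real interval $[0,1]$, $\forall$ by infimum and $\exists$ by supremum over $M$. Put $\|\varphi\|_{\mathbf M}=\inf_v\|\varphi\|_{\mathbf M,v}$. **Term structure.** The provability degree is $|\varphi|_\Phi=\sup\{r\in[0,1]\cap\mathbb Q\mid\Phi\vdash\overline r\to\varphi\}$. For terms (possibly containing variables), $t_1\sim t_2$ iff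 $|t_1\approx t_2|_\Phi=1$; this is an equivalence relation and $\overline t$ denotes the class of $t$. The term structure associated to $\Phi$ has domain $T^\Phi$ the set of all $\sim$-classes of terms, with $F_{\mathbf T^\Phi}(\overline{t_1},\dots,\overline{t_n})=\overline{F(t_1,\dots,t_n)}$ and $P_{\mathbf T^\Phi}(\overline{t_1},\dots,\overline{t_n})=|P(t_1,\dots,t_n)|_\Phi$ (these are well defined). **Horn clauses.** An evaluated formula $(\varphi,r)$ is the formula $\overline r\to\varphi$, where $r\in[0,1]$ is rational and $\varphi$ contains no truth constants other than $\overline 0,\overline 1$; it is atomic if $\varphi$ is atomic. A basic RPL$\forall$-Horn formula is a formula $(\alpha_1,r_1)\&\cdots\&(\alpha_n,r_n)\to(\beta,s)$, where $n$ is a natural number and all $(\alpha_i,r_i)$ and $(\beta,s)$ are evaluated atomic formulas; when $n=0$ it is just $(\beta,s)$. A quantifier-free RPL$\forall$-Horn formula is $\phi_1\&\cdots\&\phi_m$ with each $\phi_i$ a basic RPL$\forall$-Horn formula. An RPL$\forall$-Horn clause is $Q\gamma$, where $Q$ is a (possibly empty) string of universal quantifiers and $\gamma$ is a quantifier-free RPL$\forall$-Horn formula. *)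

theory Defs
  imports Complex_Main
begin

text \<open>The symbols of a language are the elements of the two sets \<open>Funs\<close> and \<open>Preds\<close>, so that a
  language may have no function symbols at all; constants are the function symbols of arity \<open>0\<close>.
  The similarity symbol is an ordinary binary predicate symbol of the language.\<close>

record ('f, 'p) lang =
  Funs :: "'f set"
  Preds :: "'p set"
  fun_ar :: "'f \<Rightarrow> nat"
  pred_ar :: "'p \<Rightarrow> nat"
  sim_sym :: 'p

definition wf_lang :: "('f, 'p) lang \<Rightarrow> bool" where
  "wf_lang L \<longleftrightarrow> sim_sym L \<in> Preds L \<and> pred_ar L (sim_sym L) = 2"

datatype 'f tm = Var nat | Fun 'f "'f tm list"

datatype ('f, 'p) fm =
    TConst rat
  | Pred 'p "'f tm list"
  | Imp "('f, 'p) fm" "('f, 'p) fm"  (infixr \<open>\<^bold>\<rightarrow>\<close> 60)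
  | Forall nat "('f, 'p) fm"

definition Neg :: "('f, 'p) fm \<Rightarrow> ('f, 'p) fm"  (\<open>\<^bold>\<not> _\<close> [70] 70) where
  "\<^bold>\<not> \<phi> = (\<phi> \<^bold>\<rightarrow> TConst 0)"

definition Conj :: "('f, 'p) fm \<Rightarrow> ('f, 'p) fm \<Rightarrow> ('f, 'p) fm"  (infixl \<open>\<^bold>&\<close> 65) where
  "\<phi> \<^bold>& \<psi> = \<^bold>\<not> (\<phi> \<^bold>\<rightarrow> \<^bold>\<not> \<psi>)"

definition Iff :: "('f, 'p) fm \<Rightarrow> ('f, 'p) fm \<Rightarrow> ('f, 'p) fm"  (infix \<open>\<^bold>\<leftrightarrow>\<close> 58) where
  "(\<phi> \<^bold>\<leftrightarrow> \<psi>) = ((\<phi> \<^bold>\<rightarrow> \<psi>) \<^bold>& (\<psi> \<^bold>\<rightarrow> \<phi>))"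

definition Exists :: "nat \<Rightarrow> ('f, 'p) fm \<Rightarrow> ('f, 'p) fm" where
  "Exists x \<phi> = \<^bold>\<not> (Forall x (\<^bold>\<not> \<phi>))"

definition Sim :: "('f, 'p) lang \<Rightarrow> 'f tm \<Rightarrow> 'f tm \<Rightarrow> ('f, 'p) fm" where
  "Sim L s t = Pred (sim_sym L) [s, t]"

abbreviation Foralls :: "nat list \<Rightarrow> ('f, 'p) fm \<Rightarrow> ('f, 'p) fm" where
  "Foralls xs \<phi> \<equiv> foldr Forall xs \<phi>"

text \<open>\<open>conj_imp [\<phi>\<^sub>1, \<dots>, \<phi>\<^sub>n] \<psi>\<close> is \<open>\<phi>\<^sub>1 & \<dots> & \<phi>\<^sub>n \<rightarrow> \<psi>\<close>, read as \<open>\<psi>\<close> if \<open>n = 0\<close>.\<close>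

fun conj_imp :: "('f, 'p) fm list \<Rightarrow> ('f, 'p) fm \<Rightarrow> ('f, 'p) fm" where
  "conj_imp [] \<psi> = \<psi>"
| "conj_imp (\<phi> # \<phi>s) \<psi> = (foldl Conj \<phi> \<phi>s \<^bold>\<rightarrow> \<psi>)"

fun wf_tm :: "('f, 'p) lang \<Rightarrow> 'f tm \<Rightarrow> bool" where
  "wf_tm L (Var x) \<longleftrightarrow> True"
| "wf_tm L (Fun f ts) \<longleftrightarrow> f \<in> Funs L \<and> length ts = fun_ar L f \<and> (\<forall>t \<in> set ts. wf_tm L t)"

fun wf_fm :: "('f, 'p) lang \<Rightarrow> ('f, 'p) fm \<Rightarrow> bool" where
  "wf_fm L (TConst r) \<longleftrightarrow> 0 \<le> r \<and> r \<le> 1"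
| "wf_fm L (Pred p ts) \<longleftrightarrow> p \<in> Preds L \<and> length ts = pred_ar L p \<and> (\<forall>t \<in> set ts. wf_tm L t)"
| "wf_fm L (\<phi> \<^bold>\<rightarrow> \<psi>) \<longleftrightarrow> wf_fm L \<phi> \<and> wf_fm L \<psi>"
| "wf_fm L (Forall x \<phi>) \<longleftrightarrow> wf_fm L \<phi>"

fun tm_vars :: "'f tm \<Rightarrow> nat set" where
  "tm_vars (Var x) = {x}"
| "tm_vars (Fun f ts) = (\<Union>t \<in> set ts. tm_vars t)"

fun free_vars :: "('f, 'p) fm \<Rightarrow> nat set" where
  "free_vars (TConst r) = {}"
| "free_vars (Pred p ts) = (\<Union>t \<in> set ts. tm_vars t)"
| "free_vars (\<phi> \<^bold>\<rightarrow> \<psi>) = free_vars \<phi> \<union> free_vars \<psi>"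
| "free_vars (Forall x \<phi>) = free_vars \<phi> - {x}"

fun subst_tm :: "nat \<Rightarrow> 'f tm \<Rightarrow> 'f tm \<Rightarrow> 'f tm" where
  "subst_tm x s (Var y) = (if y = x then s else Var y)"
| "subst_tm x s (Fun f ts) = Fun f (map (subst_tm x s) ts)"

text \<open>Replacement of the free occurrences of \<open>x\<close>; bound variables are not renamed.\<close>

fun subst_fm :: "nat \<Rightarrow> 'f tm \<Rightarrow> ('f, 'p) fm \<Rightarrow> ('f, 'p) fm" where
  "subst_fm x t (TConst r) = TConst r"
| "subst_fm x t (Pred p ts) = Pred p (map (subst_tm x t) ts)"
| "subst_fm x t (\<phi> \<^bold>\<rightarrow> \<psi>) = (subst_fm x t \<phi> \<^bold>\<rightarrow> subst_fm x t \<psi>)"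
| "subst_fm x t (Forall y \<phi>) = (if y = x then Forall y \<phi> else Forall y (subst_fm x t \<phi>))"

fun substitutable :: "'f tm \<Rightarrow> nat \<Rightarrow> ('f, 'p) fm \<Rightarrow> bool" where
  "substitutable t x (TConst r) \<longleftrightarrow> True"
| "substitutable t x (Pred p ts) \<longleftrightarrow> True"
| "substitutable t x (\<phi> \<^bold>\<rightarrow> \<psi>) \<longleftrightarrow> substitutable t x \<phi> \<and> substitutable t x \<psi>"
| "substitutable t x (Forall y \<phi>) \<longleftrightarrow>
     x \<notin> free_vars (Forall y \<phi>) \<or> (y \<notin> tm_vars t \<and> substitutable t x \<phi>)"

inductive rpl_axiom :: "('f, 'p) lang \<Rightarrow> ('f, 'p) fm \<Rightarrow> bool" for L where
  A1: "rpl_axiom L (\<phi> \<^bold>\<rightarrow> (\<psi> \<^bold>\<rightarrow> \<phi>))"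
| A2: "rpl_axiom L ((\<phi> \<^bold>\<rightarrow> \<psi>) \<^bold>\<rightarrow> ((\<psi> \<^bold>\<rightarrow> \<xi>) \<^bold>\<rightarrow> (\<phi> \<^bold>\<rightarrow> \<xi>)))"
| A3: "rpl_axiom L ((\<^bold>\<not> \<psi> \<^bold>\<rightarrow> \<^bold>\<not> \<phi>) \<^bold>\<rightarrow> (\<phi> \<^bold>\<rightarrow> \<psi>))"
| A4: "rpl_axiom L (((\<phi> \<^bold>\<rightarrow> \<psi>) \<^bold>\<rightarrow> \<psi>) \<^bold>\<rightarrow> ((\<psi> \<^bold>\<rightarrow> \<phi>) \<^bold>\<rightarrow> \<phi>))"
| BImp: "rpl_axiom L ((TConst r \<^bold>\<rightarrow> TConst s) \<^bold>\<leftrightarrow> TConst (min 1 (1 - r + s)))"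
| BConj: "rpl_axiom L ((TConst r \<^bold>& TConst s) \<^bold>\<leftrightarrow> TConst (max 0 (r + s - 1)))"
| Inst: "substitutable t x \<phi> \<Longrightarrow> rpl_axiom L (Forall x \<phi> \<^bold>\<rightarrow> subst_fm x t \<phi>)"
| Shift: "x \<notin> free_vars \<xi> \<Longrightarrow>
    rpl_axiom L (Forall x (\<xi> \<^bold>\<rightarrow> \<phi>) \<^bold>\<rightarrow> (\<xi> \<^bold>\<rightarrow> Forall x \<phi>))"
| S1: "rpl_axiom L (Forall x (Sim L (Var x) (Var x)))"
| S2: "x \<noteq> y \<Longrightarrow>
    rpl_axiom L (Foralls [x, y] (Sim L (Var x) (Var y) \<^bold>\<rightarrow> Sim L (Var y) (Var x)))"
| S3: "distinct [x, y, z] \<Longrightarrow>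
    rpl_axiom L (Foralls [x, y, z]
      (Sim L (Var x) (Var y) \<^bold>& Sim L (Var y) (Var z) \<^bold>\<rightarrow> Sim L (Var x) (Var z)))"
| C1: "distinct (xs @ ys) \<Longrightarrow> length xs = fun_ar L f \<Longrightarrow> length ys = fun_ar L f \<Longrightarrow>
    rpl_axiom L (Foralls (xs @ ys)
      (conj_imp (map2 (\<lambda>x y. Sim L (Var x) (Var y)) xs ys)
        (Sim L (Fun f (map Var xs)) (Fun f (map Var ys)))))"
| C2: "distinct (xs @ ys) \<Longrightarrow> length xs = pred_ar L p \<Longrightarrow> length ys = pred_ar L p \<Longrightarrow>
    rpl_axiom L (Foralls (xs @ ys)
      (conj_imp (map2 (\<lambda>x y. Sim L (Var x) (Var y)) xs ys)
        (Pred p (map Var xs) \<^bold>\<leftrightarrow> Pred p (map Var ys))))"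

text \<open>Only axiom instances that are formulas of \<open>L\<close> may be used; in particular the rationals in
  the bookkeeping axioms range over \<open>[0, 1]\<close>.\<close>

inductive provable :: "('f, 'p) lang \<Rightarrow> ('f, 'p) fm set \<Rightarrow> ('f, 'p) fm \<Rightarrow> bool" for L \<Phi> where
  Ax: "rpl_axiom L \<phi> \<Longrightarrow> wf_fm L \<phi> \<Longrightarrow> provable L \<Phi> \<phi>"
| Hyp: "\<phi> \<in> \<Phi> \<Longrightarrow> provable L \<Phi> \<phi>"
| MP: "provable L \<Phi> \<phi> \<Longrightarrow> provable L \<Phi> (\<phi> \<^bold>\<rightarrow> \<psi>) \<Longrightarrow> provable L \<Phi> \<psi>"
| Gen: "provable L \<Phi> \<phi> \<Longrightarrow> provable L \<Phi> (Forall x \<phi>)"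

definition sentence :: "('f, 'p) lang \<Rightarrow> ('f, 'p) fm \<Rightarrow> bool" where
  "sentence L \<phi> \<longleftrightarrow> wf_fm L \<phi> \<and> free_vars \<phi> = {}"

definition is_theory :: "('f, 'p) lang \<Rightarrow> ('f, 'p) fm set \<Rightarrow> bool" where
  "is_theory L \<Phi> \<longleftrightarrow> (\<forall>\<phi> \<in> \<Phi>. sentence L \<phi>)"

definition consistent :: "('f, 'p) lang \<Rightarrow> ('f, 'p) fm set \<Rightarrow> bool" where
  "consistent L \<Phi> \<longleftrightarrow> \<not> provable L \<Phi> (TConst 0)"

definition prov_degree :: "('f, 'p) lang \<Rightarrow> ('f, 'p) fm set \<Rightarrow> ('f, 'p) fm \<Rightarrow> real" where
  "prov_degree L \<Phi> \<phi> =
     Sup {real_of_rat r | r. 0 \<le> r \<and> r \<le> 1 \<and> provable L \<Phi> (TConst r \<^bold>\<rightarrow> \<phi>)}"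

record ('f, 'p, 'm) struct =
  Dom :: "'m set"
  fun_val :: "'f \<Rightarrow> 'm list \<Rightarrow> 'm"
  pred_val :: "'p \<Rightarrow> 'm list \<Rightarrow> real"

definition is_struct :: "('f, 'p) lang \<Rightarrow> ('f, 'p, 'm) struct \<Rightarrow> bool" where
  "is_struct L M \<longleftrightarrow> Dom M \<noteq> {} \<and>
     (\<forall>f \<in> Funs L. \<forall>as. length as = fun_ar L f \<and> set as \<subseteq> Dom M \<longrightarrow> fun_val M f as \<in> Dom M) \<and>
     (\<forall>p \<in> Preds L. \<forall>as. length as = pred_ar L p \<and> set as \<subseteq> Dom M \<longrightarrow>
        pred_val M p as \<in> {0..1})"

fun tm_val :: "('f, 'p, 'm) struct \<Rightarrow> (nat \<Rightarrow> 'm) \<Rightarrow> 'f tm \<Rightarrow> 'm" where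
  "tm_val M v (Var x) = v x"
| "tm_val M v (Fun f ts) = fun_val M f (map (tm_val M v) ts)"

fun fm_val :: "('f, 'p, 'm) struct \<Rightarrow> (nat \<Rightarrow> 'm) \<Rightarrow> ('f, 'p) fm \<Rightarrow> real" where
  "fm_val M v (TConst r) = real_of_rat r"
| "fm_val M v (Pred p ts) = pred_val M p (map (tm_val M v) ts)"
| "fm_val M v (\<phi> \<^bold>\<rightarrow> \<psi>) = min 1 (1 - fm_val M v \<phi> + fm_val M v \<psi>)"
| "fm_val M v (Forall x \<phi>) = (INF a \<in> Dom M. fm_val M (v(x := a)) \<phi>)"

definition truth_value :: "('f, 'p, 'm) struct \<Rightarrow> ('f, 'p) fm \<Rightarrow> real" where
  "truth_value M \<phi> = (INF v \<in> {v. range v \<subseteq> Dom M}. fm_val M v \<phi>)"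

text \<open>The defined connectives and the defined existential quantifier have the intended values.\<close>

lemma tm_val_in_Dom:
  assumes "is_struct L M" "wf_tm L t" "range v \<subseteq> Dom M"
  shows "tm_val M v t \<in> Dom M"
  using assms(2)
proof (induction t)
  case (Fun f ts)
  then show ?case
    using assms(1) by (auto simp: is_struct_def image_subset_iff)
qed (use assms(3) in auto)

lemma fm_val_bounds:
  assumes "is_struct L M" "wf_fm L \<phi>" "range v \<subseteq> Dom M"
  shows "fm_val M v \<phi> \<in> {0..1}"
  using assms(2,3)
proof (induction \<phi> arbitrary: v)
  case (Pred p ts)
  have "set (map (tm_val M v) ts) \<subseteq> Dom M"
    using Pred tm_val_in_Dom[OF assms(1)] by auto
  then show ?case
    using assms(1) Pred by (auto simp: is_struct_def)
next
  case (Forall x \<phi>)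
  have *: "fm_val M (v(x := a)) \<phi> \<in> {0..1}" if "a \<in> Dom M" for a
    using Forall.prems that by (intro Forall.IH) auto
  obtain a where a: "a \<in> Dom M"
    using assms(1) by (auto simp: is_struct_def)
  have "bdd_below ((\<lambda>a. fm_val M (v(x := a)) \<phi>) ` Dom M)"
    using * by (intro bdd_belowI[of _ 0]) auto
  then have "(INF a \<in> Dom M. fm_val M (v(x := a)) \<phi>) \<le> fm_val M (v(x := a)) \<phi>"
    using a by (rule cINF_lower)
  moreover have "0 \<le> (INF a \<in> Dom M. fm_val M (v(x := a)) \<phi>)"
    using a * by (intro cINF_greatest) auto
  ultimately show ?case
    using *[OF a] by auto
qed auto

lemma fm_val_Neg:
  assumes "is_struct L M" "wf_fm L \<phi>" "range v \<subseteq> Dom M"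
  shows "fm_val M v (\<^bold>\<not> \<phi>) = 1 - fm_val M v \<phi>"
  using fm_val_bounds[OF assms] by (auto simp: Neg_def)

lemma fm_val_Conj:
  assumes "is_struct L M" "wf_fm L \<phi>" "wf_fm L \<psi>" "range v \<subseteq> Dom M"
  shows "fm_val M v (\<phi> \<^bold>& \<psi>) = max 0 (fm_val M v \<phi> + fm_val M v \<psi> - 1)"
  using fm_val_bounds[OF assms(1,2,4)] fm_val_bounds[OF assms(1,3,4)]
  by (auto simp: Conj_def Neg_def)

lemma fm_val_Exists:
  assumes "is_struct L M" "wf_fm L \<phi>" "range v \<subseteq> Dom M"
  shows "fm_val M v (Exists x \<phi>) = (SUP a \<in> Dom M. fm_val M (v(x := a)) \<phi>)"
proof -
  let ?g = "\<lambda>a. fm_val M (v(x := a)) \<phi>"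
  have ne: "Dom M \<noteq> {}"
    using assms(1) by (simp add: is_struct_def)
  have r: "range (v(x := a)) \<subseteq> Dom M" if "a \<in> Dom M" for a
    using assms(3) that by auto
  have b: "?g a \<in> {0..1}" if "a \<in> Dom M" for a
    using fm_val_bounds[OF assms(1,2) r[OF that]] .
  have bdd: "bdd_above (?g ` Dom M)"
    using b by (intro bdd_aboveI[of _ 1]) auto
  have "(INF a \<in> Dom M. fm_val M (v(x := a)) (\<^bold>\<not> \<phi>)) = (INF a \<in> Dom M. 1 - ?g a)"
    using fm_val_Neg[OF assms(1,2) r] by (intro INF_cong) auto
  also have "\<dots> = 1 - (SUP a \<in> Dom M. ?g a)"
  proof (rule antisym)
    have "(SUP a \<in> Dom M. ?g a) \<le> 1 - (INF a \<in> Dom M. 1 - ?g a)"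
    proof (rule cSUP_least[OF ne])
      fix a assume "a \<in> Dom M"
      moreover have "bdd_below ((\<lambda>a. 1 - ?g a) ` Dom M)"
        using b by (intro bdd_belowI[of _ 0]) auto
      ultimately have "(INF a \<in> Dom M. 1 - ?g a) \<le> 1 - ?g a"
        by (intro cINF_lower)
      then show "?g a \<le> 1 - (INF a \<in> Dom M. 1 - ?g a)"
        by simp
    qed
    then show "(INF a \<in> Dom M. 1 - ?g a) \<le> 1 - (SUP a \<in> Dom M. ?g a)"
      by simp
    show "1 - (SUP a \<in> Dom M. ?g a) \<le> (INF a \<in> Dom M. 1 - ?g a)"
      using cSUP_upper[OF _ bdd] by (intro cINF_greatest[OF ne]) simp
  qed
  finally have "fm_val M v (Forall x (\<^bold>\<not> \<phi>)) = 1 - (SUP a \<in> Dom M. ?g a)"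
    by simp
  moreover have "fm_val M v (Exists x \<phi>) = 1 - fm_val M v (Forall x (\<^bold>\<not> \<phi>))"
    unfolding Exists_def using assms by (intro fm_val_Neg) (auto simp: Neg_def)
  ultimately show ?thesis
    by simp
qed

definition tm_sim :: "('f, 'p) lang \<Rightarrow> ('f, 'p) fm set \<Rightarrow> ('f tm \<times> 'f tm) set" where
  "tm_sim L \<Phi> = {(s, t). wf_tm L s \<and> wf_tm L t \<and> prov_degree L \<Phi> (Sim L s t) = 1}"

text \<open>The set \<open>listset [C\<^sub>1, \<dots>, C\<^sub>n]\<close> consists of all lists \<open>[t\<^sub>1, \<dots>, t\<^sub>n]\<close> of representatives of the
  classes \<open>C\<^sub>i\<close>. The operations on classes do not depend on the representatives (by the congruence
  axioms), so the images under \<open>the_elem\<close> are singletons and their element is the common value.\<close>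

definition term_structure ::
  "('f, 'p) lang \<Rightarrow> ('f, 'p) fm set \<Rightarrow> ('f, 'p, 'f tm set) struct" where
  "term_structure L \<Phi> = \<lparr>
     Dom = {t. wf_tm L t} // tm_sim L \<Phi>,
     fun_val = (\<lambda>f Cs. the_elem ((\<lambda>ts. tm_sim L \<Phi> `` {Fun f ts}) ` listset Cs)),
     pred_val = (\<lambda>p Cs. the_elem ((\<lambda>ts. prov_degree L \<Phi> (Pred p ts)) ` listset Cs)) \<rparr>"

text \<open>Truth constants count as atomic formulas, so the atomic formulas without truth constants
  other than \<open>0\<close> and \<open>1\<close> are the predicate atoms together with these two constants.\<close>

inductive evaluated_atomic :: "('f, 'p) fm \<Rightarrow> bool" where
  "0 \<le> r \<Longrightarrow> r \<le> 1 \<Longrightarrow> evaluated_atomic (TConst r \<^bold>\<rightarrow> Pred p ts)"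
| "0 \<le> r \<Longrightarrow> r \<le> 1 \<Longrightarrow> c = 0 \<or> c = 1 \<Longrightarrow> evaluated_atomic (TConst r \<^bold>\<rightarrow> TConst c)"

text \<open>\<open>conj_of A\<close> contains \<open>\<phi>\<^sub>1 & \<dots> & \<phi>\<^sub>n\<close>, under every bracketing, for all \<open>n \<ge> 1\<close> and all
  \<open>\<phi>\<^sub>i\<close> satisfying \<open>A\<close>.\<close>

inductive conj_of :: "(('f, 'p) fm \<Rightarrow> bool) \<Rightarrow> ('f, 'p) fm \<Rightarrow> bool" for A where
  "A \<phi> \<Longrightarrow> conj_of A \<phi>"
| "conj_of A \<phi> \<Longrightarrow> conj_of A \<psi> \<Longrightarrow> conj_of A (\<phi> \<^bold>& \<psi>)"

inductive basic_horn :: "('f, 'p) fm \<Rightarrow> bool" where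
  "evaluated_atomic \<beta> \<Longrightarrow> basic_horn \<beta>"
| "conj_of evaluated_atomic \<alpha> \<Longrightarrow> evaluated_atomic \<beta> \<Longrightarrow> basic_horn (\<alpha> \<^bold>\<rightarrow> \<beta>)"

abbreviation qf_horn :: "('f, 'p) fm \<Rightarrow> bool" where
  "qf_horn \<equiv> conj_of basic_horn"

definition horn_clause :: "('f, 'p) fm \<Rightarrow> bool" where
  "horn_clause \<phi> \<longleftrightarrow> (\<exists>xs \<gamma>. qf_horn \<gamma> \<and> \<phi> = Foralls xs \<gamma>)"

end

theory Submission
  imports Defs
begin

text \<open>The provability degree of a connective is related to the degrees of its arguments as the
  truth functions demand, except that \<open>|r \<rightarrow> \<phi>|\<close> is controlled from both sides only
  for truth constants \<open>r\<close>, and \<open>|\<phi> & \<psi>|\<close> only from below. In a Horn clause this is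
  enough: the premises of a basic Horn formula have a value in the term structure that is at most
  their degree, and the conclusion has a value that is at least its degree. Evaluating variables at
  classes of terms amounts to substituting representatives, and since the matrix of a Horn clause
  has no quantifiers, provability of the clause passes to all these substitution instances.\<close>

section \<open>Simultaneous substitution\<close>

text \<open>The instantiation axiom replaces one variable at a time, whereas an evaluation in the
  term structure acts on all variables at once. Simultaneous substitution is the syntactic
  counterpart of such an evaluation.\<close>

fun sub_tm :: "(nat \<Rightarrow> 'f tm) \<Rightarrow> 'f tm \<Rightarrow> 'f tm" where
  "sub_tm \<sigma> (Var x) = \<sigma> x"
| "sub_tm \<sigma> (Fun f ts) = Fun f (map (sub_tm \<sigma>) ts)"

fun qfree :: "('f, 'p) fm \<Rightarrow> bool" where
  "qfree (Forall x \<phi>) \<longleftrightarrow> False"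
| "qfree (\<phi> \<^bold>\<rightarrow> \<psi>) \<longleftrightarrow> qfree \<phi> \<and> qfree \<psi>"
| "qfree _ \<longleftrightarrow> True"

text \<open>Only meant for quantifier-free formulas; the clause for \<open>Forall\<close> is arbitrary.\<close>

fun sub_fm :: "(nat \<Rightarrow> 'f tm) \<Rightarrow> ('f, 'p) fm \<Rightarrow> ('f, 'p) fm" where
  "sub_fm \<sigma> (TConst r) = TConst r"
| "sub_fm \<sigma> (Pred p ts) = Pred p (map (sub_tm \<sigma>) ts)"
| "sub_fm \<sigma> (\<phi> \<^bold>\<rightarrow> \<psi>) = (sub_fm \<sigma> \<phi> \<^bold>\<rightarrow> sub_fm \<sigma> \<psi>)"
| "sub_fm \<sigma> (Forall x \<phi>) = Forall x \<phi>"

lemma wf_sub_tm: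
  "wf_tm L t \<Longrightarrow> (\<And>x. wf_tm L (\<sigma> x)) \<Longrightarrow> wf_tm L (sub_tm \<sigma> t)"
  by (induction t) auto

lemma wf_sub_fm:
  "wf_fm L \<phi> \<Longrightarrow> (\<And>x. wf_tm L (\<sigma> x)) \<Longrightarrow> wf_fm L (sub_fm \<sigma> \<phi>)"
  by (induction \<phi>) (auto simp: wf_sub_tm)

lemma sub_tm_cong: "(\<And>x. x \<in> tm_vars t \<Longrightarrow> \<sigma> x = \<tau> x) \<Longrightarrow> sub_tm \<sigma> t = sub_tm \<tau> t"
  by (induction t) auto

lemma sub_fm_cong:
  "qfree \<phi> \<Longrightarrow> (\<And>x. x \<in> free_vars \<phi> \<Longrightarrow> \<sigma> x = \<tau> x) \<Longrightarrow> sub_fm \<sigma> \<phi> = sub_fm \<tau> \<phi>"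
  by (induction \<phi>) (auto intro!: sub_tm_cong)

lemma sub_tm_Var: "sub_tm Var t = t"
  by (induction t) (auto simp: map_idI)

lemma sub_fm_Var: "sub_fm Var \<phi> = \<phi>"
  by (induction \<phi>) (auto simp: map_idI sub_tm_Var)

lemma sub_tm_sub_tm: "sub_tm \<tau> (sub_tm \<sigma> t) = sub_tm (\<lambda>x. sub_tm \<tau> (\<sigma> x)) t"
  by (induction t) auto

lemma sub_fm_sub_fm:
  "qfree \<phi> \<Longrightarrow> sub_fm \<tau> (sub_fm \<sigma> \<phi>) = sub_fm (\<lambda>x. sub_tm \<tau> (\<sigma> x)) \<phi>"
  by (induction \<phi>) (auto simp: sub_tm_sub_tm)

lemma subst_tm_eq_sub_tm: "subst_tm x s t = sub_tm (Var(x := s)) t"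
  by (induction t) auto

lemma subst_fm_eq_sub_fm: "qfree \<phi> \<Longrightarrow> subst_fm x s \<phi> = sub_fm (Var(x := s)) \<phi>"
  by (induction \<phi>) (auto simp: subst_tm_eq_sub_tm)

lemma qfree_sub_fm: "qfree \<phi> \<Longrightarrow> qfree (sub_fm \<sigma> \<phi>)"
  by (induction \<phi>) auto

lemma substitutable_qfree: "qfree \<phi> \<Longrightarrow> substitutable t x \<phi>"
  by (induction \<phi>) auto

lemma finite_tm_vars: "finite (tm_vars t)"
  by (induction t) auto

lemma finite_free_vars: "finite (free_vars \<phi>)"
  by (induction \<phi>) (auto simp: finite_tm_vars)

lemma subst_tm_Var_same: "subst_tm x (Var x) t = t"
  by (induction t) (auto simp: map_idI)

lemma subst_fm_Var_same: "subst_fm x (Var x) \<phi> = \<phi>"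
  by (induction \<phi>) (auto simp: subst_tm_Var_same map_idI)

lemma substitutable_Var_same: "substitutable (Var x) x \<phi>"
  by (induction \<phi>) auto

section \<open>Defined connectives, iterated conjunctions and Horn formulas: syntax\<close>

lemma wf_Neg [simp]: "wf_fm L (\<^bold>\<not> \<phi>) \<longleftrightarrow> wf_fm L \<phi>"
  by (simp add: Neg_def)

lemma wf_Conj [simp]: "wf_fm L (\<phi> \<^bold>& \<psi>) \<longleftrightarrow> wf_fm L \<phi> \<and> wf_fm L \<psi>"
  by (simp add: Conj_def)

lemma wf_Iff [simp]: "wf_fm L (\<phi> \<^bold>\<leftrightarrow> \<psi>) \<longleftrightarrow> wf_fm L \<phi> \<and> wf_fm L \<psi>"
  by (auto simp: Iff_def)

lemma qfree_Conj [simp]: "qfree (\<phi> \<^bold>& \<psi>) \<longleftrightarrow> qfree \<phi> \<and> qfree \<psi>"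
  by (simp add: Conj_def Neg_def)

lemma qfree_Iff [simp]: "qfree (\<phi> \<^bold>\<leftrightarrow> \<psi>) \<longleftrightarrow> qfree \<phi> \<and> qfree \<psi>"
  by (auto simp: Iff_def)

lemma qfree_Sim [simp]: "qfree (Sim L s t)"
  by (simp add: Sim_def)

lemma sub_fm_Conj [simp]: "sub_fm \<sigma> (\<phi> \<^bold>& \<psi>) = (sub_fm \<sigma> \<phi> \<^bold>& sub_fm \<sigma> \<psi>)"
  by (simp add: Conj_def Neg_def)

lemma sub_fm_Iff [simp]: "sub_fm \<sigma> (\<phi> \<^bold>\<leftrightarrow> \<psi>) = (sub_fm \<sigma> \<phi> \<^bold>\<leftrightarrow> sub_fm \<sigma> \<psi>)"
  by (simp add: Iff_def)

lemma sub_fm_Sim [simp]: "sub_fm \<sigma> (Sim L s t) = Sim L (sub_tm \<sigma> s) (sub_tm \<sigma> t)"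
  by (simp add: Sim_def)

lemma sub_fm_foldl_Conj:
  "sub_fm \<sigma> (foldl Conj \<phi> \<phi>s) = foldl Conj (sub_fm \<sigma> \<phi>) (map (sub_fm \<sigma>) \<phi>s)"
  by (induction \<phi>s arbitrary: \<phi>) auto

lemma sub_fm_conj_imp: "sub_fm \<sigma> (conj_imp \<phi>s \<psi>) = conj_imp (map (sub_fm \<sigma>) \<phi>s) (sub_fm \<sigma> \<psi>)"
  by (cases \<phi>s) (auto simp: sub_fm_foldl_Conj)

lemma wf_foldl_Conj: "wf_fm L (foldl Conj \<phi> \<phi>s) \<longleftrightarrow> wf_fm L \<phi> \<and> (\<forall>\<psi> \<in> set \<phi>s. wf_fm L \<psi>)"
  by (induction \<phi>s arbitrary: \<phi>) auto

lemma wf_conj_imp: "wf_fm L (conj_imp \<phi>s \<psi>) \<longleftrightarrow> (\<forall>\<phi> \<in> set \<phi>s. wf_fm L \<phi>) \<and> wf_fm L \<psi>"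
  by (cases \<phi>s) (auto simp: wf_foldl_Conj)

lemma qfree_foldl_Conj: "qfree (foldl Conj \<phi> \<phi>s) \<longleftrightarrow> qfree \<phi> \<and> (\<forall>\<psi> \<in> set \<phi>s. qfree \<psi>)"
  by (induction \<phi>s arbitrary: \<phi>) auto

lemma qfree_conj_imp: "qfree (conj_imp \<phi>s \<psi>) \<longleftrightarrow> (\<forall>\<phi> \<in> set \<phi>s. qfree \<phi>) \<and> qfree \<psi>"
  by (cases \<phi>s) (auto simp: qfree_foldl_Conj)

lemma wf_Foralls: "wf_fm L (Foralls xs \<phi>) \<longleftrightarrow> wf_fm L \<phi>"
  by (induction xs) auto

lemma qfree_conj_of: "conj_of A \<phi> \<Longrightarrow> (\<And>\<psi>. A \<psi> \<Longrightarrow> qfree \<psi>) \<Longrightarrow> qfree \<phi>"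
  by (induction rule: conj_of.induct) auto

lemma qfree_evaluated_atomic: "evaluated_atomic \<phi> \<Longrightarrow> qfree \<phi>"
  by (auto elim: evaluated_atomic.cases)

lemma qfree_basic_horn: "basic_horn \<phi> \<Longrightarrow> qfree \<phi>"
  by (erule basic_horn.cases)
    (auto intro: qfree_evaluated_atomic qfree_conj_of[OF _ qfree_evaluated_atomic])

lemma in_listset_iff: "ts \<in> listset Cs \<longleftrightarrow> list_all2 (\<in>) ts Cs"
  by (induction Cs arbitrary: ts) (auto simp: set_Cons_def list_all2_Cons2)

text \<open>The operations of \<open>term_structure\<close> are defined by \<open>the_elem\<close>
  of an image over all choices of representatives. Once independence of the choice is known, this
  evaluates them at one chosen list.\<close>

lemma the_elem_image:
  assumes "a \<in> A" "\<And>b. b \<in> A \<Longrightarrow> f b = f a"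
  shows "the_elem (f ` A) = f a"
proof -
  have "f ` A = (\<lambda>_. f a) ` A"
    using assms(2) by (rule image_cong[OF refl])
  also have "\<dots> = {f a}"
    using assms(1) by auto
  finally have "f ` A = {f a}" .
  then show ?thesis
    by simp
qed

section \<open>Derivations in Rational Pavelka logic\<close>

locale rpl_theory =
  fixes L :: "('f, 'p) lang" and \<Phi> :: "('f, 'p) fm set"
  assumes wf_lang: "wf_lang L" and is_theory: "is_theory L \<Phi>"
begin

abbreviation prov :: "('f, 'p) fm \<Rightarrow> bool"  (\<open>\<turnstile> _\<close> [50] 50) where
  "\<turnstile> \<phi> \<equiv> provable L \<Phi> \<phi>"

abbreviation wf :: "('f, 'p) fm \<Rightarrow> bool" where
  "wf \<equiv> wf_fm L"

abbreviation deg :: "('f, 'p) fm \<Rightarrow> real" where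
  "deg \<equiv> prov_degree L \<Phi>"

lemma wf_Sim [simp]: "wf (Sim L s t) \<longleftrightarrow> wf_tm L s \<and> wf_tm L t"
  using wf_lang by (auto simp: Sim_def wf_lang_def)

lemma prov_wf: "\<turnstile> \<phi> \<Longrightarrow> wf \<phi>"
  by (induction rule: provable.induct)
    (use is_theory in \<open>auto simp: is_theory_def sentence_def\<close>)

section \<open>Lukasiewicz propositional calculus\<close>

lemma imp_trans:
  assumes "\<turnstile> \<phi> \<^bold>\<rightarrow> \<psi>" "\<turnstile> \<psi> \<^bold>\<rightarrow> \<chi>"
  shows "\<turnstile> \<phi> \<^bold>\<rightarrow> \<chi>"
proof -
  have "\<turnstile> (\<phi> \<^bold>\<rightarrow> \<psi>) \<^bold>\<rightarrow> ((\<psi> \<^bold>\<rightarrow> \<chi>) \<^bold>\<rightarrow> (\<phi> \<^bold>\<rightarrow> \<chi>))"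
    using assms[THEN prov_wf] by (intro Ax A2) auto
  then show ?thesis
    using assms MP by blast
qed

lemma imp_weaken:
  assumes "\<turnstile> \<phi>" "wf \<psi>"
  shows "\<turnstile> \<psi> \<^bold>\<rightarrow> \<phi>"
proof -
  have "\<turnstile> \<phi> \<^bold>\<rightarrow> (\<psi> \<^bold>\<rightarrow> \<phi>)"
    using assms prov_wf by (intro Ax A1) auto
  then show ?thesis
    using assms MP by blast
qed

lemma imp_suffix:
  assumes "\<turnstile> \<phi> \<^bold>\<rightarrow> \<psi>" "wf \<chi>"
  shows "\<turnstile> (\<psi> \<^bold>\<rightarrow> \<chi>) \<^bold>\<rightarrow> (\<phi> \<^bold>\<rightarrow> \<chi>)"
proof -
  have "\<turnstile> (\<phi> \<^bold>\<rightarrow> \<psi>) \<^bold>\<rightarrow> ((\<psi> \<^bold>\<rightarrow> \<chi>) \<^bold>\<rightarrow> (\<phi> \<^bold>\<rightarrow> \<chi>))"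
    using assms prov_wf[OF assms(1)] by (intro Ax A2) auto
  then show ?thesis
    using assms MP by blast
qed

text \<open>The formula (\<phi> \<rightarrow> \<psi>) \<rightarrow> \<psi> expresses the lattice
  join, and \<open>A4\<close> is its commutativity; \<open>A1\<close> puts \<phi> below the join in
  the other order.\<close>

lemma imp_assertion:
  assumes "wf \<phi>" "wf \<psi>"
  shows "\<turnstile> \<phi> \<^bold>\<rightarrow> ((\<phi> \<^bold>\<rightarrow> \<psi>) \<^bold>\<rightarrow> \<psi>)"
proof (rule imp_trans)
  show "\<turnstile> \<phi> \<^bold>\<rightarrow> ((\<psi> \<^bold>\<rightarrow> \<phi>) \<^bold>\<rightarrow> \<phi>)"
    using assms by (intro Ax A1) auto
  show "\<turnstile> ((\<psi> \<^bold>\<rightarrow> \<phi>) \<^bold>\<rightarrow> \<phi>) \<^bold>\<rightarrow> ((\<phi> \<^bold>\<rightarrow> \<psi>) \<^bold>\<rightarrow> \<psi>)"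
    using assms by (intro Ax A4) auto
qed

text \<open>Compose \<phi> \<rightarrow> (\<psi> \<rightarrow> \<chi>) with (\<psi> \<rightarrow>
  \<chi>) \<rightarrow> \<chi> by \<open>A2\<close>, then replace the latter premise by the stronger
  \<psi>, using \<open>imp_assertion\<close>.\<close>

lemma imp_exchange:
  assumes "wf \<phi>" "wf \<psi>" "wf \<chi>"
  shows "\<turnstile> (\<phi> \<^bold>\<rightarrow> (\<psi> \<^bold>\<rightarrow> \<chi>)) \<^bold>\<rightarrow> (\<psi> \<^bold>\<rightarrow> (\<phi> \<^bold>\<rightarrow> \<chi>))"
proof (rule imp_trans)
  show "\<turnstile> (\<phi> \<^bold>\<rightarrow> (\<psi> \<^bold>\<rightarrow> \<chi>)) \<^bold>\<rightarrow> (((\<psi> \<^bold>\<rightarrow> \<chi>) \<^bold>\<rightarrow> \<chi>) \<^bold>\<rightarrow> (\<phi> \<^bold>\<rightarrow> \<chi>))"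
    using assms by (intro Ax A2) auto
  show "\<turnstile> (((\<psi> \<^bold>\<rightarrow> \<chi>) \<^bold>\<rightarrow> \<chi>) \<^bold>\<rightarrow> (\<phi> \<^bold>\<rightarrow> \<chi>)) \<^bold>\<rightarrow> (\<psi> \<^bold>\<rightarrow> (\<phi> \<^bold>\<rightarrow> \<chi>))"
    using assms by (intro imp_suffix imp_assertion) auto
qed

lemma exchange:
  assumes "\<turnstile> \<phi> \<^bold>\<rightarrow> (\<psi> \<^bold>\<rightarrow> \<chi>)"
  shows "\<turnstile> \<psi> \<^bold>\<rightarrow> (\<phi> \<^bold>\<rightarrow> \<chi>)"
  using imp_exchange[of \<phi> \<psi> \<chi>] prov_wf[OF assms] MP[OF assms] by auto

lemma imp_refl:
  assumes "wf \<phi>"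
  shows "\<turnstile> \<phi> \<^bold>\<rightarrow> \<phi>"
proof -
  have *: "\<turnstile> \<phi> \<^bold>\<rightarrow> (\<phi> \<^bold>\<rightarrow> \<phi>)"
    using assms by (intro Ax A1) auto
  \<comment> \<open>This is \<open>A1\<close> with \<psi> := \<phi> \<rightarrow> (\<phi>
    \<rightarrow> \<phi>) and its two premises exchanged. The premise is itself an instance of
    \<open>A1\<close>, so no contraction is involved.\<close>
  have "\<turnstile> (\<phi> \<^bold>\<rightarrow> (\<phi> \<^bold>\<rightarrow> \<phi>)) \<^bold>\<rightarrow> (\<phi> \<^bold>\<rightarrow> \<phi>)"
    using assms by (intro exchange[OF Ax[OF A1]]) auto
  then show ?thesis
    using * MP by blast
qed

lemma imp_prefix:
  assumes "\<turnstile> \<psi> \<^bold>\<rightarrow> \<chi>" "wf \<phi>"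
  shows "\<turnstile> (\<phi> \<^bold>\<rightarrow> \<psi>) \<^bold>\<rightarrow> (\<phi> \<^bold>\<rightarrow> \<chi>)"
proof -
  have "\<turnstile> (\<phi> \<^bold>\<rightarrow> \<psi>) \<^bold>\<rightarrow> ((\<psi> \<^bold>\<rightarrow> \<chi>) \<^bold>\<rightarrow> (\<phi> \<^bold>\<rightarrow> \<chi>))"
    using assms prov_wf[OF assms(1)] by (intro Ax A2) auto
  then show ?thesis
    using assms exchange MP by blast
qed

lemma ex_falso:
  assumes "wf \<phi>"
  shows "\<turnstile> TConst 0 \<^bold>\<rightarrow> \<phi>"
proof -
  have "\<turnstile> \<^bold>\<not> TConst 0"
    unfolding Neg_def by (rule imp_refl) simp
  then have "\<turnstile> \<^bold>\<not> \<phi> \<^bold>\<rightarrow> \<^bold>\<not> TConst 0"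
    using assms by (intro imp_weaken) auto
  moreover have "\<turnstile> (\<^bold>\<not> \<phi> \<^bold>\<rightarrow> \<^bold>\<not> TConst 0) \<^bold>\<rightarrow> (TConst 0 \<^bold>\<rightarrow> \<phi>)"
    using assms by (intro Ax A3) auto
  ultimately show ?thesis
    using MP by blast
qed

text \<open>\<open>A4\<close> with \<psi> = 0 turns the double negation into (0 \<rightarrow>
  \<phi>) \<rightarrow> \<phi>, whose premise is discharged by \<open>ex_falso\<close>.\<close>

lemma double_neg:
  assumes "wf \<phi>"
  shows "\<turnstile> \<^bold>\<not> \<^bold>\<not> \<phi> \<^bold>\<rightarrow> \<phi>"
proof -
  have "\<turnstile> ((\<phi> \<^bold>\<rightarrow> TConst 0) \<^bold>\<rightarrow> TConst 0) \<^bold>\<rightarrow> ((TConst 0 \<^bold>\<rightarrow> \<phi>) \<^bold>\<rightarrow> \<phi>)"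
    using assms by (intro Ax A4) auto
  then show ?thesis
    unfolding Neg_def using assms exchange ex_falso MP by blast
qed

text \<open>Unfolded, the conjunction is (\<phi> \<rightarrow> \<not>\<psi>) \<rightarrow> 0.
  Assertion gives \<phi> \<rightarrow> ((\<phi> \<rightarrow> \<not>\<psi>) \<rightarrow> (\<psi>
  \<rightarrow> 0)), and exchanging the two inner premises finishes.\<close>

lemma imp_conjI:
  assumes "wf \<phi>" "wf \<psi>"
  shows "\<turnstile> \<phi> \<^bold>\<rightarrow> (\<psi> \<^bold>\<rightarrow> \<phi> \<^bold>& \<psi>)"
  unfolding Conj_def Neg_def using assms
  by (intro imp_trans[OF imp_assertion imp_exchange]) auto

text \<open>Contraposing the inner implication and exchanging yields \<not>\<chi> \<rightarrow>
  (\<phi> \<rightarrow> \<not>\<psi>). Contraposing once more gives \<not>\<not>\<chi> from the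
  conjunction, and \<open>double_neg\<close> applies.\<close>

lemma conj_imp_residuate:
  assumes "\<turnstile> \<phi> \<^bold>\<rightarrow> (\<psi> \<^bold>\<rightarrow> \<chi>)"
  shows "\<turnstile> \<phi> \<^bold>& \<psi> \<^bold>\<rightarrow> \<chi>"
proof -
  have wf: "wf \<phi>" "wf \<psi>" "wf \<chi>"
    using prov_wf[OF assms] by auto
  have "\<turnstile> (\<psi> \<^bold>\<rightarrow> \<chi>) \<^bold>\<rightarrow> (\<^bold>\<not> \<chi> \<^bold>\<rightarrow> \<^bold>\<not> \<psi>)"
    unfolding Neg_def using wf by (intro Ax A2) auto
  then have "\<turnstile> \<^bold>\<not> \<chi> \<^bold>\<rightarrow> (\<phi> \<^bold>\<rightarrow> \<^bold>\<not> \<psi>)"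
    using assms exchange imp_trans by blast
  then have "\<turnstile> \<phi> \<^bold>& \<psi> \<^bold>\<rightarrow> \<^bold>\<not> \<^bold>\<not> \<chi>"
    unfolding Conj_def Neg_def[of "\<phi> \<^bold>\<rightarrow> \<^bold>\<not> \<psi>"] Neg_def[of "\<^bold>\<not> \<chi>"] by (rule imp_suffix) simp
  then show ?thesis
    using double_neg wf imp_trans by blast
qed

lemma conj_imp_left: "wf \<phi> \<Longrightarrow> wf \<psi> \<Longrightarrow> \<turnstile> \<phi> \<^bold>& \<psi> \<^bold>\<rightarrow> \<phi>"
  by (intro conj_imp_residuate Ax A1) auto

lemma conj_imp_right: "wf \<phi> \<Longrightarrow> wf \<psi> \<Longrightarrow> \<turnstile> \<phi> \<^bold>& \<psi> \<^bold>\<rightarrow> \<psi>"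
  by (intro conj_imp_residuate exchange[OF Ax[OF A1]]) auto

lemma prov_conjI:
  assumes "\<turnstile> \<phi>" "\<turnstile> \<psi>"
  shows "\<turnstile> \<phi> \<^bold>& \<psi>"
  using MP[OF assms(2) MP[OF assms(1) imp_conjI]] assms[THEN prov_wf] by blast

lemma prov_iffD1: "\<turnstile> \<phi> \<^bold>\<leftrightarrow> \<psi> \<Longrightarrow> \<turnstile> \<phi> \<^bold>\<rightarrow> \<psi>"
  using conj_imp_left[of "\<phi> \<^bold>\<rightarrow> \<psi>" "\<psi> \<^bold>\<rightarrow> \<phi>"] prov_wf[of "\<phi> \<^bold>\<leftrightarrow> \<psi>"] MP
  by (auto simp: Iff_def)

lemma prov_iffD2: "\<turnstile> \<phi> \<^bold>\<leftrightarrow> \<psi> \<Longrightarrow> \<turnstile> \<psi> \<^bold>\<rightarrow> \<phi>"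
  using conj_imp_right[of "\<phi> \<^bold>\<rightarrow> \<psi>" "\<psi> \<^bold>\<rightarrow> \<phi>"] prov_wf[of "\<phi> \<^bold>\<leftrightarrow> \<psi>"] MP
  by (auto simp: Iff_def)

lemma conj_mono:
  assumes "\<turnstile> \<phi> \<^bold>\<rightarrow> \<phi>'" "\<turnstile> \<psi> \<^bold>\<rightarrow> \<psi>'"
  shows "\<turnstile> \<phi> \<^bold>& \<psi> \<^bold>\<rightarrow> \<phi>' \<^bold>& \<psi>'"
proof (rule conj_imp_residuate)
  have wf: "wf \<phi>'" "wf \<psi>'"
    using assms[THEN prov_wf] by auto
  have "\<turnstile> \<phi> \<^bold>\<rightarrow> (\<psi>' \<^bold>\<rightarrow> \<phi>' \<^bold>& \<psi>')"
    using imp_trans[OF assms(1) imp_conjI] wf by blast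
  moreover have "\<turnstile> (\<psi>' \<^bold>\<rightarrow> \<phi>' \<^bold>& \<psi>') \<^bold>\<rightarrow> (\<psi> \<^bold>\<rightarrow> \<phi>' \<^bold>& \<psi>')"
    using imp_suffix[OF assms(2)] wf by simp
  ultimately show "\<turnstile> \<phi> \<^bold>\<rightarrow> (\<psi> \<^bold>\<rightarrow> \<phi>' \<^bold>& \<psi>')"
    by (rule imp_trans)
qed

section \<open>Derivations with truth constants as lower bounds\<close>

lemma const_conj:
  assumes "0 \<le> p" "p \<le> 1" "0 \<le> q" "q \<le> 1"
  shows "\<turnstile> (TConst p \<^bold>& TConst q) \<^bold>\<leftrightarrow> TConst (max 0 (p + q - 1))"
  using assms by (intro Ax BConj) auto

lemma const_imp:
  assumes "0 \<le> p" "p \<le> 1" "0 \<le> q" "q \<le> 1"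
  shows "\<turnstile> (TConst p \<^bold>\<rightarrow> TConst q) \<^bold>\<leftrightarrow> TConst (min 1 (1 - p + q))"
  using assms by (intro Ax BImp) auto

lemma bounded_conj:
  assumes "\<turnstile> TConst p \<^bold>\<rightarrow> \<phi>" "\<turnstile> TConst q \<^bold>\<rightarrow> \<psi>"
  shows "\<turnstile> TConst (max 0 (p + q - 1)) \<^bold>\<rightarrow> \<phi> \<^bold>& \<psi>"
  using imp_trans[OF prov_iffD2[OF const_conj] conj_mono[OF assms]] assms[THEN prov_wf] by simp

text \<open>Residuating the identity on \<phi> \<rightarrow> \<psi> gives (\<phi> \<rightarrow>
  \<psi>) & \<phi> \<rightarrow> \<psi>, so a bound for the conjunction is a bound for
  \<psi>.\<close>

lemma bounded_mp:
  assumes "\<turnstile> TConst p \<^bold>\<rightarrow> (\<phi> \<^bold>\<rightarrow> \<psi>)" "\<turnstile> TConst q \<^bold>\<rightarrow> \<phi>"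
  shows "\<turnstile> TConst (max 0 (p + q - 1)) \<^bold>\<rightarrow> \<psi>"
  using bounded_conj[OF assms] conj_imp_residuate[OF imp_refl] prov_wf[OF assms(1)] imp_trans
  by fastforce

text \<open>The bookkeeping axiom turns the constant for the value of r \<rightarrow> q into the
  implication between the two constants, whose conclusion is then weakened from q to \<phi>.\<close>

lemma bounded_imp:
  assumes "\<turnstile> TConst q \<^bold>\<rightarrow> \<phi>" "0 \<le> r" "r \<le> 1"
  shows "\<turnstile> TConst (min 1 (1 - r + q)) \<^bold>\<rightarrow> (TConst r \<^bold>\<rightarrow> \<phi>)"
  using imp_trans[OF prov_iffD2[OF const_imp] imp_prefix[OF assms(1)]] prov_wf[OF assms(1)] assms(2,3)
  by simp

text \<open>If \<open>r < 1\<close>, repeated conjunction of \<open>r\<close> with itself reaches \<open>0\<close> since every step doubles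
  the distance \<open>1 - r\<close> from \<open>1\<close>.\<close>

lemma prov_const_inconsistent:
  assumes "\<turnstile> TConst r" "r < 1"
  shows "\<turnstile> TConst 0"
proof -
  have step: "\<turnstile> TConst (max 0 (1 - 2 ^ n * (1 - r)))" for n
  proof (induction n)
    case 0
    then show ?case
      using assms prov_wf[OF assms(1)] by simp
  next
    case (Suc n)
    let ?q = "max 0 (1 - 2 ^ n * (1 - r))"
    have q: "0 \<le> ?q" "?q \<le> 1"
      using prov_wf[OF Suc] by auto
    have "\<turnstile> TConst (max 0 (?q + ?q - 1))"
      using MP[OF prov_conjI[OF Suc Suc] prov_iffD1[OF const_conj]] q by simp
    moreover have "max 0 (?q + ?q - 1) = max 0 (1 - 2 ^ Suc n * (1 - r))"
      by (simp add: max_def algebra_simps)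
    ultimately show ?case
      by simp
  qed
  obtain n where "1 / (1 - r) < 2 ^ n"
  proof -
    obtain m :: nat where "1 / (1 - r) < of_nat m"
      using reals_Archimedean2 by blast
    also have "(of_nat m :: rat) < 2 ^ m"
      using of_nat_less_iff[of m "2 ^ m", where 'a = rat] less_exp[of m] by simp
    finally show ?thesis
      using that by blast
  qed
  then have "max 0 (1 - 2 ^ n * (1 - r)) = 0"
    using assms(2) by (simp add: field_simps)
  then show ?thesis
    using step[of n] by simp
qed

section \<open>Instantiation and simultaneous substitution in provable formulas\<close>

lemma prov_Foralls_imp: "wf \<phi> \<Longrightarrow> \<turnstile> Foralls xs \<phi> \<^bold>\<rightarrow> \<phi>"
proof (induction xs)
  case Nil
  then show ?case
    by (simp add: imp_refl)
next
  case (Cons x xs)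
  \<comment> \<open>A quantifier is dropped by instantiating its variable with itself, which is
    always substitutable and changes nothing.\<close>
  have "rpl_axiom L (Forall x (Foralls xs \<phi>) \<^bold>\<rightarrow> subst_fm x (Var x) (Foralls xs \<phi>))"
    by (intro Inst substitutable_Var_same)
  then have "\<turnstile> Forall x (Foralls xs \<phi>) \<^bold>\<rightarrow> Foralls xs \<phi>"
    using Cons.prems by (intro Ax) (auto simp: subst_fm_Var_same wf_Foralls)
  then show ?case
    using imp_trans Cons by simp
qed

lemma prov_subst:
  assumes "\<turnstile> \<phi>" "qfree \<phi>" "wf_tm L t"
  shows "\<turnstile> sub_fm (Var(x := t)) \<phi>"
proof -
  have "rpl_axiom L (Forall x \<phi> \<^bold>\<rightarrow> sub_fm (Var(x := t)) \<phi>)"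
    using Inst[OF substitutable_qfree[OF assms(2)]] by (simp add: subst_fm_eq_sub_fm assms)
  then have "\<turnstile> Forall x \<phi> \<^bold>\<rightarrow> sub_fm (Var(x := t)) \<phi>"
    using assms by (intro Ax) (auto simp: prov_wf wf_sub_fm)
  then show ?thesis
    using Gen[OF assms(1)] MP by blast
qed

text \<open>Single substitutions carried out one after another agree with the simultaneous one if
  the terms inserted contain none of the variables still to be replaced.\<close>

lemma prov_sub_disjoint:
  assumes "finite S" "\<turnstile> \<phi>" "qfree \<phi>" "\<And>x. wf_tm L (\<sigma> x)"
    and "\<And>x. x \<in> S \<Longrightarrow> tm_vars (\<sigma> x) \<inter> S = {}" "\<And>x. x \<notin> S \<Longrightarrow> \<sigma> x = Var x"
  shows "\<turnstile> sub_fm \<sigma> \<phi>"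
  using assms(1,4-)
proof (induction S arbitrary: \<sigma> rule: finite_induct)
  case empty
  then have "\<sigma> = Var"
    by auto
  then show ?case
    using assms(2) by (simp add: sub_fm_Var)
next
  case (insert x S)
  \<comment> \<open>The variable \<open>x\<close> is spared at first and replaced last. The terms
    inserted before do not contain it, so the final substitution meets only the original occurrences
    of \<open>x\<close>.\<close>
  let ?\<sigma> = "\<sigma>(x := Var x)"
  have "\<turnstile> sub_fm ?\<sigma> \<phi>"
  proof (rule insert.IH)
    show "tm_vars (?\<sigma> y) \<inter> S = {}" if "y \<in> S" for y
      using that insert.prems(2)[of y] insert.hyps(2) by auto
  qed (use insert.prems in auto)
  then have "\<turnstile> sub_fm (Var(x := \<sigma> x)) (sub_fm ?\<sigma> \<phi>)"
    using assms(3) insert.prems(1) by (intro prov_subst) (auto intro: qfree_sub_fm)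
  also have "sub_fm (Var(x := \<sigma> x)) (sub_fm ?\<sigma> \<phi>) = sub_fm \<sigma> \<phi>"
  proof -
    have "sub_tm (Var(x := \<sigma> x)) (\<sigma> y) = \<sigma> y" if "y \<noteq> x" for y
    proof -
      have "x \<notin> tm_vars (\<sigma> y)"
        using insert.prems(2)[of y] insert.prems(3)[of y] that by (cases "y \<in> S") auto
      then have "sub_tm (Var(x := \<sigma> x)) (\<sigma> y) = sub_tm Var (\<sigma> y)"
        by (intro sub_tm_cong) auto
      then show ?thesis
        by (simp add: sub_tm_Var)
    qed
    then show ?thesis
      using assms(3) by (auto simp: sub_fm_sub_fm intro!: sub_fm_cong)
  qed
  finally show ?case .
qed

text \<open>A simultaneous substitution is decomposed into single ones by first renaming the variables
  to fresh ones.\<close>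

lemma prov_sub:
  assumes "\<turnstile> \<phi>" "qfree \<phi>" "\<And>x. wf_tm L (\<sigma> x)"
  shows "\<turnstile> sub_fm \<sigma> \<phi>"
proof -
  let ?S = "free_vars \<phi>"
  let ?V = "?S \<union> (\<Union>x \<in> ?S. tm_vars (\<sigma> x))"
  have "finite ?V"
    by (simp add: finite_free_vars finite_tm_vars)
  from finite_nat_set_iff_bounded[THEN iffD1, OF this] obtain n where n: "\<forall>x \<in> ?V. x < n" ..
  \<comment> \<open>All variables of \<phi> and of the terms to be inserted lie below
    \<open>n\<close>, so the shift by \<open>n\<close> produces fresh variables; \<tau> undoes the
    shift while inserting \<sigma>. Both substitutions satisfy the disjointness condition.\<close>
  define \<rho> :: "nat \<Rightarrow> 'f tm" where "\<rho> x = Var (if x \<in> ?S then x + n else x)" for x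
  define \<tau> where "\<tau> y = (if y \<in> (\<lambda>x. x + n) ` ?S then \<sigma> (y - n) else Var y)" for y
  have "\<turnstile> sub_fm \<rho> \<phi>"
  proof (rule prov_sub_disjoint[OF finite_free_vars assms(1,2)])
    show "tm_vars (\<rho> x) \<inter> ?S = {}" if "x \<in> ?S" for x
      using that n by (auto simp: \<rho>_def)
  qed (auto simp: \<rho>_def)
  then have "\<turnstile> sub_fm \<tau> (sub_fm \<rho> \<phi>)"
  proof (rule prov_sub_disjoint[rotated])
    show "tm_vars (\<tau> y) \<inter> (\<lambda>x. x + n) ` ?S = {}" if "y \<in> (\<lambda>x. x + n) ` ?S" for y
      using that n by (fastforce simp: \<tau>_def)
  qed (auto simp: \<tau>_def finite_free_vars qfree_sub_fm assms)
  also have "sub_fm \<tau> (sub_fm \<rho> \<phi>) = sub_fm \<sigma> \<phi>"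
    unfolding sub_fm_sub_fm[OF assms(2)]
    by (rule sub_fm_cong[OF assms(2)]) (auto simp: \<rho>_def \<tau>_def)
  finally show ?thesis .
qed

lemma prov_closure_sub:
  assumes "\<turnstile> Foralls xs \<phi>" "qfree \<phi>" "\<And>x. wf_tm L (\<sigma> x)"
  shows "\<turnstile> sub_fm \<sigma> \<phi>"
  using prov_wf[OF assms(1)] assms
  by (intro prov_sub MP[OF assms(1) prov_Foralls_imp]) (auto simp: wf_Foralls)

section \<open>Provability degrees\<close>

lemma deg_upper:
  assumes "\<turnstile> TConst r \<^bold>\<rightarrow> \<phi>"
  shows "real_of_rat r \<le> deg \<phi>"
  unfolding prov_degree_def using assms prov_wf[OF assms]
  by (intro cSup_upper bdd_aboveI[of _ 1]) auto

text \<open>The set of rational lower bounds is never empty, since \<open>ex_falso\<close> puts 0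
  into it; hence the supremum is below every upper bound.\<close>

lemma deg_least:
  assumes "wf \<phi>" "\<And>r. 0 \<le> r \<Longrightarrow> r \<le> 1 \<Longrightarrow> \<turnstile> TConst r \<^bold>\<rightarrow> \<phi> \<Longrightarrow> real_of_rat r \<le> b"
  shows "deg \<phi> \<le> b"
  unfolding prov_degree_def
proof (rule cSup_least)
  show "{real_of_rat r |r. 0 \<le> r \<and> r \<le> 1 \<and> \<turnstile> TConst r \<^bold>\<rightarrow> \<phi>} \<noteq> {}"
    using ex_falso[OF assms(1)] by auto (metis order_refl zero_le_one)
qed (use assms(2) in auto)

lemma deg_nonneg: "wf \<phi> \<Longrightarrow> 0 \<le> deg \<phi>"
  using deg_upper[OF ex_falso] by simp

lemma deg_le_1: "wf \<phi> \<Longrightarrow> deg \<phi> \<le> 1"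
  by (rule deg_least) auto

lemma deg_prov:
  assumes "\<turnstile> \<phi>"
  shows "deg \<phi> = 1"
proof (rule antisym)
  show "1 \<le> deg \<phi>"
    using deg_upper[OF imp_weaken[OF assms, of "TConst 1"]] by simp
qed (rule deg_le_1[OF prov_wf[OF assms]])

text \<open>The inequality holds for rational lower bounds by \<open>bounded_conj\<close>. The two
  suprema are then taken one after the other, each time with the other bound moved to the right-hand
  side. The same scheme proves \<open>deg_mp\<close>.\<close>

lemma deg_conj:
  assumes "wf \<phi>" "wf \<psi>"
  shows "deg \<phi> + deg \<psi> - 1 \<le> deg (\<phi> \<^bold>& \<psi>)"
proof -
  have "real_of_rat p + real_of_rat q - 1 \<le> deg (\<phi> \<^bold>& \<psi>)"
    if "\<turnstile> TConst p \<^bold>\<rightarrow> \<phi>" "\<turnstile> TConst q \<^bold>\<rightarrow> \<psi>" for p q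
    using deg_upper[OF bounded_conj[OF that]]
    by (metis (no_types) max.cobounded2 of_rat_1 of_rat_add of_rat_diff of_rat_less_eq order_trans)
  then have "deg \<phi> \<le> deg (\<phi> \<^bold>& \<psi>) - real_of_rat q + 1" if "\<turnstile> TConst q \<^bold>\<rightarrow> \<psi>" for q
    using assms(1) that by (intro deg_least) (auto simp: algebra_simps)
  then have "deg \<psi> \<le> deg (\<phi> \<^bold>& \<psi>) - deg \<phi> + 1"
    using assms(2) by (intro deg_least) (auto simp: algebra_simps)
  then show ?thesis
    by simp
qed

lemma deg_mp:
  assumes "wf \<phi>" "wf \<psi>"
  shows "deg (\<phi> \<^bold>\<rightarrow> \<psi>) + deg \<phi> - 1 \<le> deg \<psi>"
proof -
  have "real_of_rat p + real_of_rat q - 1 \<le> deg \<psi>"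
    if "\<turnstile> TConst p \<^bold>\<rightarrow> (\<phi> \<^bold>\<rightarrow> \<psi>)" "\<turnstile> TConst q \<^bold>\<rightarrow> \<phi>" for p q
    using deg_upper[OF bounded_mp[OF that]]
    by (metis (no_types) max.cobounded2 of_rat_1 of_rat_add of_rat_diff of_rat_less_eq order_trans)
  then have "deg (\<phi> \<^bold>\<rightarrow> \<psi>) \<le> deg \<psi> - real_of_rat q + 1" if "\<turnstile> TConst q \<^bold>\<rightarrow> \<phi>" for q
    using assms that by (intro deg_least) (auto simp: algebra_simps)
  then have "deg \<phi> \<le> deg \<psi> - deg (\<phi> \<^bold>\<rightarrow> \<psi>) + 1"
    using assms(1) by (intro deg_least) (auto simp: algebra_simps)
  then show ?thesis
    by simp
qed

lemma deg_mono: "\<turnstile> \<phi> \<^bold>\<rightarrow> \<psi> \<Longrightarrow> deg \<phi> \<le> deg \<psi>"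
  using deg_mp[of \<phi> \<psi>] deg_prov[of "\<phi> \<^bold>\<rightarrow> \<psi>"] prov_wf[of "\<phi> \<^bold>\<rightarrow> \<psi>"] by simp

lemma deg_const_ge: "0 \<le> r \<Longrightarrow> r \<le> 1 \<Longrightarrow> real_of_rat r \<le> deg (TConst r)"
  by (intro deg_upper imp_refl) auto

lemma deg_const_imp_ge:
  assumes "wf \<phi>" "0 \<le> r" "r \<le> 1"
  shows "min 1 (1 - real_of_rat r + deg \<phi>) \<le> deg (TConst r \<^bold>\<rightarrow> \<phi>)"
proof (cases "deg (TConst r \<^bold>\<rightarrow> \<phi>) \<ge> 1")
  case False
  have "deg \<phi> \<le> deg (TConst r \<^bold>\<rightarrow> \<phi>) - 1 + real_of_rat r"
  proof (rule deg_least[OF assms(1)])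
    fix q assume "\<turnstile> TConst q \<^bold>\<rightarrow> \<phi>"
    from deg_upper[OF bounded_imp[OF this assms(2,3)]]
    show "real_of_rat q \<le> deg (TConst r \<^bold>\<rightarrow> \<phi>) - 1 + real_of_rat r"
      \<comment> \<open>If the minimum in the bound were 1, the degree of the implication would be
        at least 1, which this case excludes.\<close>
      using False by (auto simp: min_def of_rat_add of_rat_diff split: if_splits)
  qed
  then show ?thesis
    by simp
qed simp

text \<open>Degrees obey modus ponens by \<open>deg_mp\<close>, and the premise, a truth constant,
  has degree at least its own value.\<close>

lemma deg_const_imp_le:
  assumes "wf \<phi>" "0 \<le> r" "r \<le> 1"
  shows "deg (TConst r \<^bold>\<rightarrow> \<phi>) \<le> min 1 (1 - real_of_rat r + deg \<phi>)"
  using deg_mp[of "TConst r" \<phi>] deg_const_ge[of r] deg_le_1[of "TConst r \<^bold>\<rightarrow> \<phi>"] assms by simp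

text \<open>Consistency enters here. A lower bound r for 0 makes the constant 1 - r provable, which
  is inconsistent unless r = 0.\<close>

lemma deg_zero:
  assumes "consistent L \<Phi>"
  shows "deg (TConst 0) = 0"
proof (rule antisym)
  show "deg (TConst 0) \<le> 0"
  proof (rule deg_least)
    fix r :: rat assume r: "0 \<le> r" "r \<le> 1" "\<turnstile> TConst r \<^bold>\<rightarrow> TConst 0"
    then have "\<turnstile> TConst (1 - r)"
      using MP[OF r(3) prov_iffD1[OF const_imp[of r 0]]] by simp
    then have "\<not> 1 - r < 1"
      using prov_const_inconsistent assms unfolding consistent_def by blast
    then show "real_of_rat r \<le> 0"
      by simp
  qed simp
qed (simp add: deg_nonneg)

text \<open>Truth constants are untouched by substitution, so every rational lower bound for \<phi>
  remains one for the instance.\<close>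

lemma deg_sub:
  assumes "wf \<phi>" "qfree \<phi>" "\<And>x. wf_tm L (\<sigma> x)"
  shows "deg \<phi> \<le> deg (sub_fm \<sigma> \<phi>)"
proof (rule deg_least[OF assms(1)])
  fix r assume "\<turnstile> TConst r \<^bold>\<rightarrow> \<phi>"
  then have "\<turnstile> sub_fm \<sigma> (TConst r \<^bold>\<rightarrow> \<phi>)"
    using assms by (intro prov_sub) auto
  then show "real_of_rat r \<le> deg (sub_fm \<sigma> \<phi>)"
    by (simp add: deg_upper)
qed

lemma deg_conj_eq_1:
  assumes "wf \<phi>" "wf \<psi>" "deg \<phi> = 1" "deg \<psi> = 1"
  shows "deg (\<phi> \<^bold>& \<psi>) = 1"
  using deg_conj[OF assms(1,2)] deg_le_1[of "\<phi> \<^bold>& \<psi>"] assms by simp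

lemma deg_foldl_Conj_eq_1:
  assumes "\<And>\<psi>. \<psi> \<in> set (\<phi> # \<phi>s) \<Longrightarrow> wf \<psi> \<and> deg \<psi> = 1"
  shows "deg (foldl Conj \<phi> \<phi>s) = 1"
  using assms
proof (induction \<phi>s arbitrary: \<phi>)
  case (Cons \<psi> \<phi>s)
  show ?case
    using Cons.prems by (auto intro!: Cons.IH deg_conj_eq_1)
qed simp

text \<open>Similarity of terms only gives premises of degree 1, which may fail to be provable. The
  congruence axioms are therefore applied at the level of degrees instead of by modus
  ponens.\<close>

lemma deg_conj_imp_le:
  assumes "\<turnstile> conj_imp \<phi>s \<psi>" "\<And>\<phi>. \<phi> \<in> set \<phi>s \<Longrightarrow> deg \<phi> = 1"
  shows "deg \<psi> = 1"
proof (cases \<phi>s)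
  case Nil
  then show ?thesis
    using assms deg_prov by simp
next
  case (Cons \<phi> \<phi>s')
  have wf: "\<forall>\<phi> \<in> set \<phi>s. wf \<phi>" "wf \<psi>"
    using prov_wf[OF assms(1)] by (auto simp: wf_conj_imp)
  have "deg (foldl Conj \<phi> \<phi>s') = 1"
    using wf assms(2) Cons by (intro deg_foldl_Conj_eq_1) auto
  moreover have "deg (foldl Conj \<phi> \<phi>s') \<le> deg \<psi>"
    using assms(1) Cons by (intro deg_mono) simp
  ultimately show ?thesis
    using deg_le_1[OF wf(2)] by simp
qed

section \<open>The term structure\<close>

abbreviation terms :: "'f tm set" where
  "terms \<equiv> {t. wf_tm L t}"

abbreviation cls :: "'f tm \<Rightarrow> 'f tm set" where
  "cls t \<equiv> tm_sim L \<Phi> `` {t}"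

section \<open>Similarity as a congruence\<close>

lemma deg_Sim_refl: "wf_tm L t \<Longrightarrow> deg (Sim L t t) = 1"
  using prov_closure_sub[of "[0]" "Sim L (Var 0) (Var 0)" "\<lambda>_. t"] Ax[OF S1[of L 0]]
  by (simp add: deg_prov)

lemma deg_Sim_sym:
  assumes "wf_tm L s" "wf_tm L t"
  shows "deg (Sim L s t) \<le> deg (Sim L t s)"
proof -
  have "\<turnstile> Foralls [0, 1] (Sim L (Var 0) (Var 1) \<^bold>\<rightarrow> Sim L (Var 1) (Var 0))"
    by (intro Ax S2) auto
  from prov_closure_sub[OF this, of "\<lambda>x. if x = 0 then s else t"] show ?thesis
    using assms by (auto intro: deg_mono)
qed

lemma deg_Sim_trans:
  assumes "wf_tm L s" "wf_tm L t" "wf_tm L u"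
  shows "deg (Sim L s t \<^bold>& Sim L t u) \<le> deg (Sim L s u)"
proof -
  have "\<turnstile> Foralls [0, 1, 2] (Sim L (Var 0) (Var 1) \<^bold>& Sim L (Var 1) (Var 2) \<^bold>\<rightarrow> Sim L (Var 0) (Var 2))"
    by (intro Ax S3) auto
  from prov_closure_sub[OF this, of "\<lambda>x. if x = 0 then s else if x = 1 then t else u"]
  show ?thesis
    using assms by (auto intro: deg_mono)
qed

lemma equiv_tm_sim: "equiv terms (tm_sim L \<Phi>)"
proof (rule equivI)
  show "tm_sim L \<Phi> \<subseteq> terms \<times> terms"
    by (auto simp: tm_sim_def)
  show "refl_on terms (tm_sim L \<Phi>)"
    by (auto simp: refl_on_def tm_sim_def deg_Sim_refl)
  show "sym (tm_sim L \<Phi>)"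
  proof (rule symI)
    fix s t assume "(s, t) \<in> tm_sim L \<Phi>"
    then show "(t, s) \<in> tm_sim L \<Phi>"
      using deg_Sim_sym[of s t] deg_le_1[of "Sim L t s"] by (auto simp: tm_sim_def)
  qed
  show "trans (tm_sim L \<Phi>)"
  proof (rule transI)
    fix s t u assume "(s, t) \<in> tm_sim L \<Phi>" "(t, u) \<in> tm_sim L \<Phi>"
    then show "(s, u) \<in> tm_sim L \<Phi>"
      using deg_Sim_trans[of s t u] deg_conj_eq_1[of "Sim L s t" "Sim L t u"]
        deg_le_1[of "Sim L s u"]
      by (auto simp: tm_sim_def)
  qed
qed

lemma wf_tm_simD:
  assumes "list_all2 (\<lambda>s t. (s, t) \<in> tm_sim L \<Phi>) ss ts"
  shows "\<forall>s \<in> set ss. wf_tm L s" "\<forall>t \<in> set ts. wf_tm L t"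
  using assms by (auto simp: tm_sim_def list_all2_conv_all_nth in_set_conv_nth)

text \<open>The common form of \<open>C1\<close> and \<open>C2\<close>: \<psi> stands for the
  conclusion as a function of the two argument lists, and \<open>sub\<close> says that it commutes
  with substitution.\<close>

lemma congruence_degree:
  assumes closure: "\<And>xs ys. distinct (xs @ ys) \<Longrightarrow> length xs = n \<Longrightarrow> length ys = n \<Longrightarrow>
      \<turnstile> Foralls (xs @ ys)
        (conj_imp (map2 (\<lambda>x y. Sim L (Var x) (Var y)) xs ys) (\<psi> (map Var xs) (map Var ys)))"
    and qf: "\<And>ss ts. qfree (\<psi> ss ts)"
    and sub: "\<And>\<sigma> ss ts. sub_fm \<sigma> (\<psi> ss ts) = \<psi> (map (sub_tm \<sigma>) ss) (map (sub_tm \<sigma>) ts)"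
    and sim: "list_all2 (\<lambda>s t. (s, t) \<in> tm_sim L \<Phi>) ss ts" and len: "length ss = n"
  shows "deg (\<psi> ss ts) = 1"
proof -
  let ?xs = "[0..<n]" and ?ys = "[n..<n + n]"
  have len': "length ts = n"
    using sim len by (simp add: list_all2_lengthD)
  \<comment> \<open>The first \<open>n\<close> variables receive \<open>ss\<close> and the next
    \<open>n\<close> receive \<open>ts\<close>, so one substitution instance of the closed axiom
    speaks about both lists.\<close>
  define \<sigma> where "\<sigma> x = (if x < n then ss ! x else if x < n + n then ts ! (x - n) else Var x)" for x
  have wf: "wf_tm L (\<sigma> x)" for x
    using wf_tm_simD[OF sim] len len' by (auto simp: \<sigma>_def)
  have xs: "map (\<lambda>x. \<sigma> x) ?xs = ss" and ys: "map (\<lambda>x. \<sigma> x) ?ys = ts"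
    using len len' by (auto simp: \<sigma>_def intro!: nth_equalityI)
  have "distinct (?xs @ ?ys)"
    by auto
  from closure[OF this] have "\<turnstile> Foralls (?xs @ ?ys)
      (conj_imp (map2 (\<lambda>x y. Sim L (Var x) (Var y)) ?xs ?ys) (\<psi> (map Var ?xs) (map Var ?ys)))"
    by simp
  then have "\<turnstile> sub_fm \<sigma> (conj_imp (map2 (\<lambda>x y. Sim L (Var x) (Var y)) ?xs ?ys)
      (\<psi> (map Var ?xs) (map Var ?ys)))"
    using qf wf by (elim prov_closure_sub) (auto simp: qfree_conj_imp)
  also have "sub_fm \<sigma> (conj_imp (map2 (\<lambda>x y. Sim L (Var x) (Var y)) ?xs ?ys)
      (\<psi> (map Var ?xs) (map Var ?ys))) =
    conj_imp (map2 (\<lambda>x y. Sim L (\<sigma> x) (\<sigma> y)) ?xs ?ys) (\<psi> ss ts)"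
    using xs ys by (simp add: sub_fm_conj_imp sub comp_def case_prod_unfold)
  also have "map2 (\<lambda>x y. Sim L (\<sigma> x) (\<sigma> y)) ?xs ?ys = map2 (Sim L) ss ts"
    using len len' by (auto simp: \<sigma>_def intro!: nth_equalityI)
  finally show ?thesis
    using sim by (elim deg_conj_imp_le)
      (auto simp: set_zip list_all2_conv_all_nth tm_sim_def)
qed

lemma tm_sim_Fun:
  assumes "f \<in> Funs L" "length ss = fun_ar L f"
    and sim: "list_all2 (\<lambda>s t. (s, t) \<in> tm_sim L \<Phi>) ss ts"
  shows "(Fun f ss, Fun f ts) \<in> tm_sim L \<Phi>"
proof -
  have "deg (Sim L (Fun f ss) (Fun f ts)) = 1"
  proof (rule congruence_degree[where n = "fun_ar L f"
        and \<psi> = "\<lambda>ss ts. Sim L (Fun f ss) (Fun f ts)", OF _ _ _ sim assms(2)])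
    fix xs ys :: "nat list"
    assume "length xs = fun_ar L f" "length ys = fun_ar L f" and "distinct (xs @ ys)"
    then show "\<turnstile> Foralls (xs @ ys) (conj_imp (map2 (\<lambda>x y. Sim L (Var x) (Var y)) xs ys)
        (Sim L (Fun f (map Var xs)) (Fun f (map Var ys))))"
      using assms(1) by (intro Ax C1) (auto simp only: wf_Foralls wf_conj_imp, auto)
  qed simp_all
  then show ?thesis
    using assms wf_tm_simD[OF sim] list_all2_lengthD[OF sim] by (auto simp: tm_sim_def)
qed

text \<open>The equivalence of the two atoms has degree 1, hence so do both implications, and
  \<open>deg_mp\<close> gives an inequality of degrees in each direction.\<close>

lemma deg_Pred_cong:
  assumes "p \<in> Preds L" "length ss = pred_ar L p"
    and sim: "list_all2 (\<lambda>s t. (s, t) \<in> tm_sim L \<Phi>) ss ts"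
  shows "deg (Pred p ss) = deg (Pred p ts)"
proof -
  let ?S = "Pred p ss" and ?T = "Pred p ts"
  have wf: "wf ?S" "wf ?T"
    using assms wf_tm_simD[OF sim] list_all2_lengthD[OF sim] by auto
  have "deg (?S \<^bold>\<leftrightarrow> ?T) = 1"
  proof (rule congruence_degree[where n = "pred_ar L p"
        and \<psi> = "\<lambda>ss ts. Pred p ss \<^bold>\<leftrightarrow> Pred p ts", OF _ _ _ sim assms(2)])
    fix xs ys :: "nat list"
    assume "length xs = pred_ar L p" "length ys = pred_ar L p" and "distinct (xs @ ys)"
    then show "\<turnstile> Foralls (xs @ ys) (conj_imp (map2 (\<lambda>x y. Sim L (Var x) (Var y)) xs ys)
        (Pred p (map Var xs) \<^bold>\<leftrightarrow> Pred p (map Var ys)))"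
      using assms(1) by (intro Ax C2) (auto simp only: wf_Foralls wf_conj_imp, auto)
  qed simp_all
  then have "1 \<le> deg (?S \<^bold>\<rightarrow> ?T)" "1 \<le> deg (?T \<^bold>\<rightarrow> ?S)"
    using deg_mono[OF conj_imp_left, of "?S \<^bold>\<rightarrow> ?T" "?T \<^bold>\<rightarrow> ?S"]
      deg_mono[OF conj_imp_right, of "?S \<^bold>\<rightarrow> ?T" "?T \<^bold>\<rightarrow> ?S"] wf
    by (auto simp: Iff_def)
  then show ?thesis
    using deg_mp[OF wf] deg_mp[OF wf(2,1)] by simp
qed

section \<open>Operations and values at classes of terms\<close>

lemma in_listset_cls:
  "ss \<in> listset (map cls ts) \<longleftrightarrow> list_all2 (\<lambda>t s. (t, s) \<in> tm_sim L \<Phi>) ts ss"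
  by (auto simp: in_listset_iff list_all2_conv_all_nth)

lemma cls_refl:
  assumes "\<forall>t \<in> set ts. wf_tm L t"
  shows "ts \<in> listset (map cls ts)"
  unfolding in_listset_cls list_all2_same using assms by (auto simp: tm_sim_def deg_Sim_refl)

lemma fun_val_cls:
  assumes "wf_tm L (Fun f ts)"
  shows "fun_val (term_structure L \<Phi>) f (map cls ts) = cls (Fun f ts)"
proof -
  have "cls (Fun f ss) = cls (Fun f ts)" if "ss \<in> listset (map cls ts)" for ss
    using that assms equiv_class_eq[OF equiv_tm_sim tm_sim_Fun[of f ts ss]]
    by (simp add: in_listset_cls)
  moreover have "ts \<in> listset (map cls ts)"
    using assms by (intro cls_refl) simp
  ultimately have "the_elem ((\<lambda>ts. cls (Fun f ts)) ` listset (map cls ts)) = cls (Fun f ts)"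
    by (intro the_elem_image)
  then show ?thesis
    by (simp add: term_structure_def)
qed

lemma pred_val_cls:
  assumes "wf (Pred p ts)"
  shows "pred_val (term_structure L \<Phi>) p (map cls ts) = deg (Pred p ts)"
proof -
  have "deg (Pred p ss) = deg (Pred p ts)" if "ss \<in> listset (map cls ts)" for ss
    using that assms deg_Pred_cong[of p ts ss] by (simp add: in_listset_cls)
  moreover have "ts \<in> listset (map cls ts)"
    using assms by (intro cls_refl) simp
  ultimately have "the_elem ((\<lambda>ts. deg (Pred p ts)) ` listset (map cls ts)) = deg (Pred p ts)"
    by (intro the_elem_image)
  then show ?thesis
    by (simp add: term_structure_def)
qed

lemma tm_val_cls:
  assumes "wf_tm L t" "\<And>x. wf_tm L (\<sigma> x)"
  shows "tm_val (term_structure L \<Phi>) (\<lambda>x. cls (\<sigma> x)) t = cls (sub_tm \<sigma> t)"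
  using assms(1)
proof (induction t)
  case (Fun f ts)
  let ?us = "map (sub_tm \<sigma>) ts"
  have "map (tm_val (term_structure L \<Phi>) (\<lambda>x. cls (\<sigma> x))) ts = map cls ?us"
    using Fun by (simp add: comp_def)
  moreover have "wf_tm L (Fun f ?us)"
    using wf_sub_tm[OF Fun.prems assms(2)] by simp
  ultimately show ?case
    using fun_val_cls[of f ?us] by (simp only: tm_val.simps sub_tm.simps)
qed simp

lemma Pred_val_cls:
  assumes "wf (Pred p ts)" "\<And>x. wf_tm L (\<sigma> x)"
  shows "fm_val (term_structure L \<Phi>) (\<lambda>x. cls (\<sigma> x)) (Pred p ts) = deg (sub_fm \<sigma> (Pred p ts))"
proof -
  let ?us = "map (sub_tm \<sigma>) ts"
  have "map (tm_val (term_structure L \<Phi>) (\<lambda>x. cls (\<sigma> x))) ts = map cls ?us"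
    using assms by (simp add: comp_def tm_val_cls)
  moreover have "wf (Pred p ?us)"
    using wf_sub_fm[OF assms] by simp
  ultimately show ?thesis
    using pred_val_cls[of p ?us] by (simp only: fm_val.simps sub_fm.simps)
qed

section \<open>Horn clauses in the term structure\<close>

context
  fixes \<sigma> :: "nat \<Rightarrow> 'f tm"
  assumes consistent: "consistent L \<Phi>" and wf_\<sigma>: "\<And>x. wf_tm L (\<sigma> x)"
begin

abbreviation val :: "('f, 'p) fm \<Rightarrow> real" where
  "val \<equiv> fm_val (term_structure L \<Phi>) (\<lambda>x. cls (\<sigma> x))"

text \<open>Value and degree agree exactly: for predicate atoms by construction of the term
  structure, for 0 by consistency, and an implication from a truth constant preserves agreement
  because its degree is bounded on both sides.\<close>

lemma val_evaluated_atomic: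
  assumes "evaluated_atomic \<phi>" "wf \<phi>"
  shows "val \<phi> = deg (sub_fm \<sigma> \<phi>)"
proof -
  obtain r \<alpha> where \<phi>: "\<phi> = (TConst r \<^bold>\<rightarrow> \<alpha>)" "0 \<le> r" "r \<le> 1"
    and \<alpha>: "(\<exists>p ts. \<alpha> = Pred p ts) \<or> \<alpha> = TConst 0 \<or> \<alpha> = TConst 1"
    using assms(1) by cases auto
  have wf: "wf (sub_fm \<sigma> \<alpha>)"
    using assms(2) \<phi> wf_\<sigma> by (simp add: wf_sub_fm)
  have "val \<alpha> = deg (sub_fm \<sigma> \<alpha>)"
    using \<alpha>
  proof (elim disjE exE)
    fix p ts assume "\<alpha> = Pred p ts"
    then show ?thesis
      using Pred_val_cls[OF _ wf_\<sigma>, of p ts] assms(2) \<phi>(1) by simp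
  next
    assume "\<alpha> = TConst 1"
    then show ?thesis
      using deg_const_ge[of 1] deg_le_1[of "TConst 1"] by simp
  qed (simp add: deg_zero[OF consistent])
  then show ?thesis
    using deg_const_imp_ge[OF wf \<phi>(2,3)] deg_const_imp_le[OF wf \<phi>(2,3)] by (simp add: \<phi>(1))
qed

text \<open>Only an inequality survives, as \<open>deg_conj\<close> bounds the degree of a
  conjunction from below. Nonnegativity is carried along because, with the upper bound 1 on degrees,
  it resolves the truncations in the unfolded conjunction.\<close>

lemma val_conj_of_evaluated_atomic:
  assumes "conj_of evaluated_atomic \<phi>" "wf \<phi>"
  shows "0 \<le> val \<phi> \<and> val \<phi> \<le> deg (sub_fm \<sigma> \<phi>)"
  using assms
proof (induction rule: conj_of.induct)
  case (1 \<phi>)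
  then show ?case
    using val_evaluated_atomic deg_nonneg wf_sub_fm[OF _ wf_\<sigma>] by simp
next
  case (2 \<phi> \<psi>)
  have wf: "wf (sub_fm \<sigma> \<phi>)" "wf (sub_fm \<sigma> \<psi>)"
    using 2 wf_sub_fm[OF _ wf_\<sigma>] by auto
  have "val (\<phi> \<^bold>& \<psi>) = max 0 (val \<phi> + val \<psi> - 1)"
    using 2 deg_le_1[OF wf(1)] deg_le_1[OF wf(2)] by (auto simp: Conj_def Neg_def)
  then show ?case
    using 2 deg_conj[OF wf] deg_nonneg[of "sub_fm \<sigma> \<phi> \<^bold>& sub_fm \<sigma> \<psi>"] wf by auto
qed

text \<open>The inequality for the premise points the right way: its value is at most its degree,
  hence at most the degree of the conclusion, which equals the value of the conclusion.\<close>

lemma val_basic_horn: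
  assumes "basic_horn \<phi>" "wf \<phi>" "deg (sub_fm \<sigma> \<phi>) = 1"
  shows "val \<phi> = 1"
  using assms(1)
proof cases
  case 1
  then show ?thesis
    using val_evaluated_atomic[OF _ assms(2)] assms(3) by simp
next
  case (2 \<alpha> \<beta>)
  have wf: "wf (sub_fm \<sigma> \<alpha>)" "wf (sub_fm \<sigma> \<beta>)"
    using 2 assms wf_sub_fm[OF _ wf_\<sigma>] by auto
  have "val \<alpha> \<le> deg (sub_fm \<sigma> \<alpha>)"
    using val_conj_of_evaluated_atomic 2 assms by simp
  also have "\<dots> \<le> deg (sub_fm \<sigma> \<beta>)"
    using deg_mp[OF wf] assms(3) 2 by simp
  also have "\<dots> = val \<beta>"
    using val_evaluated_atomic 2 assms by simp
  finally show ?thesis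
    using 2 by simp
qed

lemma val_qf_horn:
  assumes "qf_horn \<phi>" "wf \<phi>" "deg (sub_fm \<sigma> \<phi>) = 1"
  shows "val \<phi> = 1"
  using assms
proof (induction rule: conj_of.induct)
  case (1 \<phi>)
  then show ?case
    using val_basic_horn by simp
next
  case (2 \<phi> \<psi>)
  have wf: "wf (sub_fm \<sigma> \<phi>)" "wf (sub_fm \<sigma> \<psi>)"
    using 2 wf_sub_fm[OF _ wf_\<sigma>] by auto
  have "deg (sub_fm \<sigma> \<phi>) = 1" "deg (sub_fm \<sigma> \<psi>) = 1"
    using deg_mono[OF conj_imp_left[OF wf]] deg_mono[OF conj_imp_right[OF wf]] 2
      deg_le_1[OF wf(1)] deg_le_1[OF wf(2)] by auto
  then show ?case
    using 2 by (simp add: Conj_def Neg_def)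
qed

end

section \<open>Arbitrary evaluations and quantifier prefixes\<close>

lemma Dom_term_structure: "Dom (term_structure L \<Phi>) = terms // tm_sim L \<Phi>"
  by (simp add: term_structure_def)

lemma Dom_term_structure_nonempty: "Dom (term_structure L \<Phi>) \<noteq> {}"
proof -
  have "cls (Var 0) \<in> terms // tm_sim L \<Phi>"
    by (rule quotientI) simp
  then show ?thesis
    unfolding Dom_term_structure by (metis empty_iff)
qed

lemma representatives:
  assumes "range v \<subseteq> Dom (term_structure L \<Phi>)"
  obtains \<sigma> where "v = (\<lambda>x. cls (\<sigma> x))" "\<And>x. wf_tm L (\<sigma> x)"
proof -
  have "\<exists>t. v x = cls t \<and> wf_tm L t" for x
  proof -
    have "v x \<in> terms // tm_sim L \<Phi>"
      using assms Dom_term_structure by auto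
    then show ?thesis
      by (elim quotientE) blast
  qed
  then obtain \<sigma> where \<sigma>: "\<And>x. v x = cls (\<sigma> x)" "\<And>x. wf_tm L (\<sigma> x)"
    by metis
  show ?thesis
    by (rule that[of \<sigma>]) (auto simp: \<sigma>)
qed

lemma qf_horn_val:
  assumes "consistent L \<Phi>" "qf_horn \<gamma>" "wf \<gamma>" "deg \<gamma> = 1" "range v \<subseteq> Dom (term_structure L \<Phi>)"
  shows "fm_val (term_structure L \<Phi>) v \<gamma> = 1"
proof -
  obtain \<sigma> where v: "v = (\<lambda>x. cls (\<sigma> x))" and wf: "\<And>x. wf_tm L (\<sigma> x)"
    using representatives[OF assms(5)] by blast
  have "qfree \<gamma>"
    using assms(2) qfree_conj_of qfree_basic_horn by blast
  then have "deg (sub_fm \<sigma> \<gamma>) = 1"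
    using deg_sub[of \<gamma> \<sigma>] deg_le_1[OF wf_sub_fm[of L \<gamma> \<sigma>]] assms wf by simp
  then show ?thesis
    using val_qf_horn assms wf v by simp
qed

lemma horn_clause_truth_value:
  assumes "consistent L \<Phi>" "horn_clause \<phi>" "wf \<phi>" "deg \<phi> = 1"
  shows "truth_value (term_structure L \<Phi>) \<phi> = 1"
proof -
  let ?T = "term_structure L \<Phi>"
  let ?V = "{v :: nat \<Rightarrow> 'f tm set. range v \<subseteq> Dom ?T}"
  obtain xs \<gamma> where \<gamma>: "qf_horn \<gamma>" and \<phi>: "\<phi> = Foralls xs \<gamma>"
    using assms(2) unfolding horn_clause_def by blast
  have wf: "wf \<gamma>"
    using assms(3) \<phi> by (simp add: wf_Foralls)
  have deg: "deg \<gamma> = 1"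
    using deg_mono[OF prov_Foralls_imp[OF wf, of xs]] deg_le_1[OF wf] assms(4) \<phi> by simp
  \<comment> \<open>The matrix has value 1 under every evaluation, so each quantifier of the prefix
    takes the infimum of the constant 1 over a non-empty domain.\<close>
  have val: "fm_val ?T v (Foralls ys \<gamma>) = 1" if "range v \<subseteq> Dom ?T" for ys v
    using that
  proof (induction ys arbitrary: v)
    case Nil
    then show ?case
      using qf_horn_val assms(1) \<gamma> wf deg by simp
  next
    case (Cons y ys)
    have "fm_val ?T (v(y := a)) (Foralls ys \<gamma>) = 1" if "a \<in> Dom ?T" for a
      using Cons.prems that by (intro Cons.IH) auto
    then show ?case
      using Dom_term_structure_nonempty by simp
  qed
  obtain a where "a \<in> Dom ?T"
    using Dom_term_structure_nonempty by blast
  then have "(\<lambda>_. a) \<in> ?V"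
    by auto
  then have ne: "?V \<noteq> {}"
    by (metis empty_iff)
  have "truth_value ?T \<phi> = (INF v \<in> ?V. 1)"
    unfolding truth_value_def \<phi> by (rule INF_cong[OF refl], rule val) blast
  also have "\<dots> = 1"
    using ne by (rule cINF_const)
  finally show ?thesis .
qed

end

theorem theorem3:
  fixes L :: "('f, 'p) lang" and \<Phi> :: "('f, 'p) fm set" and \<phi> :: "('f, 'p) fm"
  assumes "wf_lang L"
    and "is_theory L \<Phi>"
    and "consistent L \<Phi>"
    and "horn_clause \<phi>"
    and "sentence L \<phi>"
    and "prov_degree L \<Phi> \<phi> = 1"
  shows "truth_value (term_structure L \<Phi>) \<phi> = 1"
proof -
  interpret rpl_theory L \<Phi>
    using assms by unfold_locales
  show ?thesis
    using horn_clause_truth_value assms by (simp add: sentence_def)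
qed

end
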